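(* Let $Y$ be any sequence space and suppose that the entries of the infinite complex matrices $A=(a_{nk})_{n,k\ge1}$ and $H=(h_{nk})_{n,k\ge1}$ are connected by the relation $$h_{nk}=n\,a_{nk}-(n-1)\,a_{n-1,k}\qquad\text{for all }k,n\ge1$$ (so $h_{1k}=a_{1k}$). Then $A\in(Y:\int bv)$ if and only if $H\in(Y:\ell_1)$.
   Context: All sequences are complex sequences $x=(x_k)_{k\ge 1}$; $\omega$ is the space of all of them; a sequence space is a linear subspace of $\omega$. $\int bv=\{x\in\omega:\sum_{k\ge1}|k x_k-(k-1)x_{k-1}|<\infty\}$, where the term for $k=1$ is $|x_1|$. For sequence spaces $X,Y$, $(X:Y)$ denotes the class of infinite matrices $A=(a_{nk})$ such that for every $x\in X$ the series $(Ax)_n=\sum_k a_{nk}x_k$ converges for each $n$ and $Ax=((Ax)_n)_n\in Y$. *)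

theory Defs
  imports Complex_Main "HOL-Library.Function_Algebras"
begin

text \<open>
  Sequences \<open>(x\<^sub>k)\<close> with \<open>k \<ge> 1\<close> are functions on \<open>nat\<close> whose entry at the unused index \<open>0\<close>
  is normalised to \<open>0\<close>, so that each such sequence has exactly one representative.
\<close>

definition omega :: "(nat \<Rightarrow> complex) set" where
  "omega = {x. x 0 = 0}"

definition seq_scale :: "complex \<Rightarrow> (nat \<Rightarrow> complex) \<Rightarrow> nat \<Rightarrow> complex" where
  "seq_scale c x = (\<lambda>k. c * x k)"

global_interpretation seq: vector_space seq_scale
  by unfold_locales (auto simp: seq_scale_def fun_eq_iff algebra_simps)

definition sequence_space :: "(nat \<Rightarrow> complex) set \<Rightarrow> bool" where
  "sequence_space Y \<longleftrightarrow> Y \<subseteq> omega \<and> seq.subspace Y"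

text \<open>Series over \<open>k \<ge> 1\<close> are written with index \<open>Suc k\<close>, where \<open>k\<close> ranges over \<open>nat\<close>.\<close>

definition ell1 :: "(nat \<Rightarrow> complex) set" where
  "ell1 = {x \<in> omega. summable (\<lambda>k. norm (x (Suc k)))}"

text \<open>For \<open>k = 0\<close> the summand below is \<open>norm (x 1)\<close>.\<close>

definition int_bv :: "(nat \<Rightarrow> complex) set" where
  "int_bv = {x \<in> omega. summable (\<lambda>k. norm (of_nat (Suc k) * x (Suc k) - of_nat k * x k))}"

text \<open>
  An infinite matrix is a function of its row and column index; only its entries with both
  indices at least \<open>1\<close> are ever used.
\<close>

definition mat_app :: "(nat \<Rightarrow> nat \<Rightarrow> complex) \<Rightarrow> (nat \<Rightarrow> complex) \<Rightarrow> nat \<Rightarrow> complex" where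
  "mat_app A x = (\<lambda>n. if n = 0 then 0 else (\<Sum>k. A n (Suc k) * x (Suc k)))"

definition matrix_class ::
  "(nat \<Rightarrow> complex) set \<Rightarrow> (nat \<Rightarrow> complex) set \<Rightarrow> (nat \<Rightarrow> nat \<Rightarrow> complex) set" where
  "matrix_class X Y =
     {A. \<forall>x\<in>X. (\<forall>n\<ge>1. summable (\<lambda>k. A n (Suc k) * x (Suc k))) \<and> mat_app A x \<in> Y}"

end

theory Submission
  imports Defs
begin

text \<open>Fix \<open>x\<close> in \<open>Y\<close> and put y = Ax. The relation says that row n of
  \<open>H\<close> is n times row n of \<open>A\<close> minus n-1 times row n-1, so (Hx)_n = n y_n -
  (n-1) y_(n-1) by linearity of convergent series (\<open>mat_app_difference\<close>). These are
  exactly the terms whose absolute summability defines \<open>int_bv\<close>, so Ax lies in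
  \<open>int_bv\<close> iff Hx lies in \<open>ell1\<close>. This presupposes that the row series
  converge; \<open>summable_rows_iff\<close> shows that they do so for \<open>A\<close> and
  \<open>H\<close> simultaneously, since telescoping recovers n a_nk as the sum of h_jk over j from
  1 to n.\<close>

lemma summable_rows_iff:
  fixes A H :: "nat \<Rightarrow> nat \<Rightarrow> complex" and x :: "nat \<Rightarrow> complex"
  assumes rel: "\<And>n k. H (Suc n) (Suc k) =
                  of_nat (Suc n) * A (Suc n) (Suc k) - of_nat n * A n (Suc k)"
  shows "(\<forall>n\<ge>1. summable (\<lambda>k. A n (Suc k) * x (Suc k))) \<longleftrightarrow>
         (\<forall>n\<ge>1. summable (\<lambda>k. H n (Suc k) * x (Suc k)))"
    (is "(\<forall>n\<ge>1. summable (?a n)) \<longleftrightarrow> (\<forall>n\<ge>1. summable (?h n))")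
proof -
  have h: "?h (Suc n) = (\<lambda>k. of_nat (Suc n) * ?a (Suc n) k - of_nat n * ?a n k)" for n
    by (simp add: rel algebra_simps)
  show ?thesis
  proof (intro iffI allI impI)
    fix n :: nat
    assume a: "\<forall>n\<ge>1. summable (?a n)" and "n \<ge> 1"
    then obtain m where n: "n = Suc m" by (cases n) auto
    \<comment> \<open>For \<open>m = 0\<close> nothing is known about row 0 of \<open>A\<close>, but
      the coefficient 0 annihilates it.\<close>
    have "summable (\<lambda>k. of_nat m * ?a m k)"
      using a by (cases "m = 0") (auto intro: summable_mult)
    moreover have "summable (\<lambda>k. of_nat (Suc m) * ?a (Suc m) k)"
      using a by (intro summable_mult) simp
    ultimately show "summable (?h n)"
      unfolding n h by (rule summable_diff[rotated])
  next
    fix n :: nat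
    assume hs: "\<forall>n\<ge>1. summable (?h n)" and "n \<ge> 1"
    \<comment> \<open>Keeping the weight \<open>n\<close> in the claim makes the case 0 trivial and
      lets the relation telescope; the weight is divided out only at the end, where it is
      nonzero.\<close>
    have "summable (\<lambda>k. of_nat n * ?a n k)" for n
    proof (induction n)
      case 0
      show ?case by simp
    next
      case (Suc m)
      have "summable (?h (Suc m))" using hs by simp
      from summable_add[OF this Suc]
      have "summable (\<lambda>k. ?h (Suc m) k + of_nat m * ?a m k)" .
      moreover have "?h (Suc m) k + of_nat m * ?a m k = of_nat (Suc m) * ?a (Suc m) k" for k
        by (simp add: rel algebra_simps)
      ultimately show ?case by (simp only:)
    qed
    from summable_mult_D[OF this] \<open>n \<ge> 1\<close> show "summable (?a n)" by simp
  qed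
qed

lemma mat_app_difference:
  fixes A H :: "nat \<Rightarrow> nat \<Rightarrow> complex" and x :: "nat \<Rightarrow> complex"
  assumes rel: "\<And>n k. H (Suc n) (Suc k) =
                  of_nat (Suc n) * A (Suc n) (Suc k) - of_nat n * A n (Suc k)"
    and rows: "\<And>n. n \<ge> 1 \<Longrightarrow> summable (\<lambda>k. A n (Suc k) * x (Suc k))"
  shows "mat_app H x (Suc n) = of_nat (Suc n) * mat_app A x (Suc n) - of_nat n * mat_app A x n"
proof -
  \<comment> \<open>Including \<open>m = 0\<close>, where both sides vanish, spares the first row of
    \<open>H\<close> a separate treatment.\<close>
  have "(\<lambda>k. of_nat m * (A m (Suc k) * x (Suc k))) sums (of_nat m * mat_app A x m)" for m
  proof (cases "m = 0")
    case False
    then show ?thesis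
      using rows[of m] by (auto simp: mat_app_def intro: sums_mult summable_sums)
  qed simp
  from sums_diff[OF this[of "Suc n"] this[of n]]
  have "(\<lambda>k. H (Suc n) (Suc k) * x (Suc k)) sums
          (of_nat (Suc n) * mat_app A x (Suc n) - of_nat n * mat_app A x n)"
    by (simp add: rel algebra_simps)
  then show ?thesis by (simp add: mat_app_def sums_iff)
qed

theorem theorem4p4:
  fixes Y :: "(nat \<Rightarrow> complex) set"
    and A H :: "nat \<Rightarrow> nat \<Rightarrow> complex"
  assumes "sequence_space Y"
    and "\<And>n k. n \<ge> 1 \<Longrightarrow> k \<ge> 1 \<Longrightarrow>
           H n k = of_nat n * A n k - of_nat (n - 1) * A (n - 1) k"
  shows "A \<in> matrix_class Y int_bv \<longleftrightarrow> H \<in> matrix_class Y ell1"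
proof -
  have rel: "H (Suc n) (Suc k) = of_nat (Suc n) * A (Suc n) (Suc k) - of_nat n * A n (Suc k)"
    for n k
    using assms(2)[of "Suc n" "Suc k"] by simp
  have omega: "mat_app B x \<in> omega" for B x
    by (simp add: omega_def mat_app_def)
  have "mat_app A x \<in> int_bv \<longleftrightarrow> mat_app H x \<in> ell1"
    if "\<forall>n\<ge>1. summable (\<lambda>k. A n (Suc k) * x (Suc k))" for x
    using mat_app_difference[of H A x, OF rel] that omega
    by (simp add: int_bv_def ell1_def del: of_nat_Suc)
  with summable_rows_iff[of H A, OF rel] show ?thesis
    \<comment> \<open>\<open>conj_cong\<close> lets the two memberships be compared under the
      assumption that the rows converge, which the preceding equivalence needs.\<close>
    unfolding matrix_class_def mem_Collect_eq by (intro ball_cong refl conj_cong) simp_all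
qed

end
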